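(* Let $\alpha\in[\tfrac12,1)$ be fixed. Suppose there exist a constant $b>0$ and, for every positive integer $n$, a connected graph $Q(n)$ on $n$ vertices with cop number $c(Q(n))\ge b\,n^{\alpha}$ (i.e., there is a family of connected graphs of all orders $n$ with cop number $\Omega(n^{\alpha})$). Then there exist connected graphs $H_n$ on $n$ vertices with $\operatorname{th}_c(H_n)=\Omega\!\left(n^{1/(2-\alpha)}\right)$.
   Context: Graphs are finite, simple and undirected. In the game of Cops and Robbers on a graph $G$, the cops first choose a multiset $S$ of vertices to occupy, then the robber chooses a vertex; in each round every cop moves to an adjacent vertex or stays, then the robber does likewise; both players have perfect information, and the robber is captured when a cop occupies the robber's vertex. The cop number $c(G)$ is the minimum number of cops that can guarantee capture. For a multiset $S$ of vertices, $\operatorname{capt}(G;S)$ is the number of rounds until capture when the cops start on $S$ and both sides play optimally (the cops minimizing, the robber, including the choice of start vertex, maximizing); it is $\infty$ if the cops cannot guarantee capture. For $k\ge 1$, $\operatorname{capt}_k(G)=\min_{|S|=k}\operatorname{capt}(G;S)$ (infinite if $k<c(G)$). The cop throttling number is $\operatorname{th}_c(G)=\min_k\{k+\operatorname{capt}_k(G)\}$. *)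

theory Defs
  imports
    "Graph_Theory.Graph_Theory"
    "HOL-Library.Multiset"
    "HOL-Library.Extended_Nat"
    "HOL-Library.Landau_Symbols"
begin

text \<open>
  A finite simple undirected graph is a \<^term>\<open>G :: 'a pair_pre_digraph\<close> with \<^term>\<open>pair_graph G\<close>:
  finite, loop-free, with a symmetric set of arcs, so that \<^term>\<open>{u, v}\<close> is an edge iff
  \<^term>\<open>(u, v) \<in> parcs G\<close>.
\<close>

definition step :: "'a pair_pre_digraph \<Rightarrow> 'a \<Rightarrow> 'a \<Rightarrow> bool" where
  "step G u v \<longleftrightarrow> u = v \<or> (u, v) \<in> parcs G"

text \<open>
  A state is the multiset of the cops' vertices together with the robber's vertex. A history lists
  the states at the ends of the rounds played so far, most recent first; the last entry is the
  state after the initial placement. The cops' strategy maps a history to the next multiset of cop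
  positions, the robber's strategy maps a history and the cops' new positions to the robber's next
  vertex; on the empty history it gives the robber's start vertex.
\<close>

type_synonym 'a history = "('a multiset \<times> 'a) list"
type_synonym 'a cop_strategy = "'a history \<Rightarrow> 'a multiset"
type_synonym 'a robber_strategy = "'a history \<Rightarrow> 'a multiset \<Rightarrow> 'a"

definition cop_strategies :: "'a pair_pre_digraph \<Rightarrow> 'a cop_strategy set" where
  "cop_strategies G = {\<sigma>. \<forall>C r h. rel_mset (step G) C (\<sigma> ((C, r) # h))}"

definition robber_strategies :: "'a pair_pre_digraph \<Rightarrow> 'a robber_strategy set" where
  "robber_strategies G =
     {\<rho>. (\<forall>C. \<rho> [] C \<in> pverts G) \<and> (\<forall>C r h C'. step G r (\<rho> ((C, r) # h) C'))}"

primrec play :: "'a multiset \<Rightarrow> 'a cop_strategy \<Rightarrow> 'a robber_strategy \<Rightarrow> nat \<Rightarrow> 'a history" where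
  "play S \<sigma> \<rho> 0 = [(S, \<rho> [] S)]"
| "play S \<sigma> \<rho> (Suc t) =
     (let h = play S \<sigma> \<rho> t; C = \<sigma> h in (C, \<rho> h C) # h)"

definition cops_at :: "'a multiset \<Rightarrow> 'a cop_strategy \<Rightarrow> 'a robber_strategy \<Rightarrow> nat \<Rightarrow> 'a multiset" where
  "cops_at S \<sigma> \<rho> t = fst (hd (play S \<sigma> \<rho> t))"

definition robber_at :: "'a multiset \<Rightarrow> 'a cop_strategy \<Rightarrow> 'a robber_strategy \<Rightarrow> nat \<Rightarrow> 'a" where
  "robber_at S \<sigma> \<rho> t = snd (hd (play S \<sigma> \<rho> t))"

text \<open>
  In a round the robber can be captured either by the cops' move or by his own move. A play is
  formally continued beyond capture; only the first capture counts for \<open>capture_time\<close>.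
\<close>

fun caught_in_round ::
  "'a multiset \<Rightarrow> 'a cop_strategy \<Rightarrow> 'a robber_strategy \<Rightarrow> nat \<Rightarrow> bool" where
  "caught_in_round S \<sigma> \<rho> 0 \<longleftrightarrow> robber_at S \<sigma> \<rho> 0 \<in># S"
| "caught_in_round S \<sigma> \<rho> (Suc t) \<longleftrightarrow>
     robber_at S \<sigma> \<rho> t \<in># cops_at S \<sigma> \<rho> (Suc t) \<or>
     robber_at S \<sigma> \<rho> (Suc t) \<in># cops_at S \<sigma> \<rho> (Suc t)"

definition capture_time :: "'a multiset \<Rightarrow> 'a cop_strategy \<Rightarrow> 'a robber_strategy \<Rightarrow> enat" where
  "capture_time S \<sigma> \<rho> = (INF t\<in>{t. caught_in_round S \<sigma> \<rho> t}. enat t)"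

definition placements :: "'a pair_pre_digraph \<Rightarrow> nat \<Rightarrow> 'a multiset set" where
  "placements G k = {S. set_mset S \<subseteq> pverts G \<and> size S = k}"

definition cops_win :: "'a pair_pre_digraph \<Rightarrow> 'a multiset \<Rightarrow> bool" where
  "cops_win G S \<longleftrightarrow>
     (\<exists>\<sigma>\<in>cop_strategies G. \<forall>\<rho>\<in>robber_strategies G. capture_time S \<sigma> \<rho> < \<infinity>)"

definition cop_number :: "'a pair_pre_digraph \<Rightarrow> nat" where
  "cop_number G = (LEAST k. \<exists>S\<in>placements G k. cops_win G S)"

definition capt :: "'a pair_pre_digraph \<Rightarrow> 'a multiset \<Rightarrow> enat" where
  "capt G S = (INF \<sigma>\<in>cop_strategies G. SUP \<rho>\<in>robber_strategies G. capture_time S \<sigma> \<rho>)"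

definition capt_k :: "nat \<Rightarrow> 'a pair_pre_digraph \<Rightarrow> enat" where
  "capt_k k G = (INF S\<in>placements G k. capt G S)"

definition cop_throttling :: "'a pair_pre_digraph \<Rightarrow> enat" where
  "cop_throttling G = (INF k\<in>{1..}. enat k + capt_k k G)"

text \<open>
  The throttling number of a nonempty graph is finite, so \<^const>\<open>the_enat\<close> may be applied to it.
\<close>

lemma stay_in_cop_strategies: "(\<lambda>h. fst (hd h)) \<in> cop_strategies G"
proof -
  have "rel_mset (step G) C C" for C
    by (rule multiset.rel_refl) (simp add: step_def)
  then show ?thesis by (simp add: cop_strategies_def)
qed

lemma cop_throttling_le_card:
  assumes "finite (pverts G)" "pverts G \<noteq> {}"
  shows "cop_throttling G \<le> enat (card (pverts G))"
proof -
  let ?S = "mset_set (pverts G)" and ?k = "card (pverts G)"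
  have "capture_time ?S (\<lambda>h. fst (hd h)) \<rho> \<le> 0" if "\<rho> \<in> robber_strategies G" for \<rho>
  proof -
    have "caught_in_round ?S (\<lambda>h. fst (hd h)) \<rho> 0"
      using that assms by (simp add: robber_strategies_def robber_at_def)
    then have "capture_time ?S (\<lambda>h. fst (hd h)) \<rho> \<le> enat 0"
      unfolding capture_time_def by (intro INF_lower) simp
    then show ?thesis by (simp add: zero_enat_def)
  qed
  then have "capt G ?S \<le> 0"
    unfolding capt_def by (intro INF_lower2[OF stay_in_cop_strategies] SUP_least)
  moreover have "?S \<in> placements G ?k"
    using assms by (simp add: placements_def)
  ultimately have "capt_k ?k G \<le> 0"
    unfolding capt_k_def by (rule INF_lower2[rotated])
  then have "enat ?k + capt_k ?k G \<le> enat ?k" by simp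
  moreover have "?k \<in> {1..}"
    using assms by (simp add: Suc_le_eq card_gt_0_iff)
  ultimately show ?thesis
    unfolding cop_throttling_def by (rule INF_lower2[rotated])
qed

end

theory Submission
  imports Defs
begin

text \<open>
  Put \<open>m \<approx> n\<^sup>\<gamma>\<close> with \<open>\<gamma> = 1 / (2 - \<alpha>)\<close> and join \<open>s \<approx> n / (2 m)\<close> copies of \<open>Q m\<close>
  to a common hub by paths of length about \<open>m\<close>. If fewer than \<open>s\<close> times \<open>cop_number (Q m)\<close> cops
  are placed, then some copy together with its path holds fewer than \<open>cop_number (Q m)\<close> of them.
  The robber hides in that copy: the other cops need more than \<open>m\<close> rounds to reach it, and the
  path retracts onto its attaching vertex, so that the robber evades the remaining cops as in
  \<open>Q m\<close>. Hence the throttling number is at least the minimum of \<open>s\<close> times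
  \<open>cop_number (Q m)\<close> and \<open>m + 1\<close>, and both are at least of order \<open>n\<^sup>\<gamma>\<close>.
\<close>

section \<open>Evasion over a fixed number of rounds\<close>

text \<open>Who wins the game cut off after \<open>t\<close> further rounds depends on the position
  alone. Unfolding the negation yields a cop move, so this recursion gives determinacy without
  reference to histories.\<close>

primrec evades :: "'a pair_pre_digraph \<Rightarrow> nat \<Rightarrow> 'a multiset \<Rightarrow> 'a \<Rightarrow> bool" where
  "evades G 0 C r \<longleftrightarrow> r \<notin># C"
| "evades G (Suc t) C r \<longleftrightarrow> r \<notin># C \<and>
     (\<forall>C'. rel_mset (step G) C C' \<longrightarrow> r \<notin># C' \<and> (\<exists>r'. step G r r' \<and> evades G t C' r'))"

lemma evades_not_caught: "evades G t C r \<Longrightarrow> r \<notin># C"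
  by (cases t) auto

lemma play_conv_Cons:
  "\<exists>h. play S \<sigma> \<rho> t = (cops_at S \<sigma> \<rho> t, robber_at S \<sigma> \<rho> t) # h \<and> length h = t"
proof (induction t)
  case (Suc t)
  then have "length (play S \<sigma> \<rho> t) = Suc t" by auto
  then show ?case by (simp add: cops_at_def robber_at_def Let_def)
qed (simp add: cops_at_def robber_at_def)

lemma cops_at_Suc: "cops_at S \<sigma> \<rho> (Suc t) = \<sigma> (play S \<sigma> \<rho> t)"
  by (simp add: cops_at_def Let_def)

lemma robber_at_Suc: "robber_at S \<sigma> \<rho> (Suc t) = \<rho> (play S \<sigma> \<rho> t) (cops_at S \<sigma> \<rho> (Suc t))"
  by (simp add: robber_at_def cops_at_def Let_def)

lemma caught_in_roundI: "robber_at S \<sigma> \<rho> t \<in># cops_at S \<sigma> \<rho> t \<Longrightarrow> caught_in_round S \<sigma> \<rho> t"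
  by (cases t) (auto simp: cops_at_def)

text \<open>Contrapositive: if every start vertex loses within \<open>T\<close> rounds, the cops can
  keep the robber in losing positions until capture, so they win from \<open>C\<close>, against the
  minimality of \<open>cop_number G\<close>.\<close>

lemma evades_if_few_cops:
  assumes "size C < cop_number G" and "set_mset C \<subseteq> pverts G"
  shows "\<exists>r\<in>pverts G. evades G T C r"
proof (rule ccontr)
  assume "\<not> ?thesis"
  then have doomed: "\<not> evades G T C r" if "r \<in> pverts G" for r using that by blast
  define good where "good t D r D' \<longleftrightarrow> rel_mset (step G) D D' \<and>
      (r \<in># D' \<or> (\<forall>r'. step G r r' \<longrightarrow> \<not> evades G t D' r'))" for t D r D'
  \<comment> \<open>The history after round \<open>j\<close> has length \<open>j + 1\<close>, so
    \<open>T - length h\<close> counts the rounds left once the coming round is over. Staying put is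
    the default where no good move exists.\<close>
  define \<sigma> where "\<sigma> h = (case h of [] \<Rightarrow> C | (D, r) # h' \<Rightarrow>
      if \<exists>D'. good (T - length h) D r D' then SOME D'. good (T - length h) D r D' else D)" for h
  have refl: "rel_mset (step G) D D" for D
    by (rule multiset.rel_refl) (simp add: step_def)
  have \<sigma>: "\<sigma> \<in> cop_strategies G"
    unfolding cop_strategies_def
  proof (clarify)
    fix D r h
    show "rel_mset (step G) D (\<sigma> ((D, r) # h))"
    proof (cases "\<exists>D'. good (T - length ((D, r) # h)) D r D'")
      case True
      then have "\<sigma> ((D, r) # h) = (SOME D'. good (T - length ((D, r) # h)) D r D')"
        by (simp add: \<sigma>_def)
      with someI_ex[OF True] have "good (T - length ((D, r) # h)) D r (\<sigma> ((D, r) # h))" by simp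
      then show ?thesis unfolding good_def by blast
    next
      case False
      then show ?thesis by (auto simp: \<sigma>_def refl)
    qed
  qed
  have "capture_time C \<sigma> \<rho> < \<infinity>" if \<rho>: "\<rho> \<in> robber_strategies G" for \<rho>
  proof -
    let ?C = "cops_at C \<sigma> \<rho>" and ?r = "robber_at C \<sigma> \<rho>"
    \<comment> \<open>Play formally continues after capture, so a capture in any round is allowed as
      an alternative.\<close>
    have inv: "(\<exists>i. caught_in_round C \<sigma> \<rho> i) \<or> \<not> evades G (T - j) (?C j) (?r j)" if "j \<le> T" for j
      using that
    proof (induction j)
      case 0
      then show ?case using doomed[of "?r 0"] \<rho>
        by (simp add: cops_at_def robber_at_def robber_strategies_def)
    next
      case (Suc j)
      obtain h where h: "play C \<sigma> \<rho> j = (?C j, ?r j) # h" "length h = j"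
        using play_conv_Cons by metis
      have T: "T - j = Suc (T - Suc j)" using Suc.prems by simp
      consider "\<exists>i. caught_in_round C \<sigma> \<rho> i" | "?r j \<in># ?C j"
        | D' where "good (T - Suc j) (?C j) (?r j) D'"
        using Suc unfolding T good_def by fastforce
      then show ?case
      proof cases
        case 2
        then show ?thesis using caught_in_roundI by blast
      next
        case 3
        then have ex: "\<exists>D'. good (T - Suc j) (?C j) (?r j) D'" by blast
        have "?C (Suc j) = (SOME D'. good (T - Suc j) (?C j) (?r j) D')"
          using ex h by (simp add: cops_at_Suc \<sigma>_def)
        then have g: "good (T - Suc j) (?C j) (?r j) (?C (Suc j))"
          using someI_ex[OF ex] by simp
        have "step G (?r j) (?r (Suc j))"
          using \<rho> h by (simp add: robber_at_Suc robber_strategies_def)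
        with g have "?r j \<in># ?C (Suc j) \<or> \<not> evades G (T - Suc j) (?C (Suc j)) (?r (Suc j))"
          unfolding good_def by blast
        moreover have "caught_in_round C \<sigma> \<rho> (Suc j)" if "?r j \<in># ?C (Suc j)"
          using that by simp
        ultimately show ?thesis by blast
      qed blast
    qed
    \<comment> \<open>With no rounds left, failing to evade means standing on a cop's
      vertex.\<close>
    obtain i where "caught_in_round C \<sigma> \<rho> i"
      using inv[of T] caught_in_roundI[of C \<sigma> \<rho> T] by auto
    then have "capture_time C \<sigma> \<rho> \<le> enat i"
      unfolding capture_time_def by (intro INF_lower) simp
    then show ?thesis using enat_ord_simps(4) le_less_trans by blast
  qed
  then have "cops_win G C" unfolding cops_win_def using \<sigma> by blast
  moreover have "C \<in> placements G (size C)" using assms by (simp add: placements_def)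
  ultimately have "cop_number G \<le> size C" unfolding cop_number_def by (blast intro: Least_le)
  with assms show False by simp
qed

text \<open>The dual strategy: the robber always moves to a position from which the remaining rounds
  can be survived, so no capture occurs in rounds \<open>0\<close> to \<open>T\<close>.\<close>

lemma capt_ge_if_evades:
  assumes r0: "r0 \<in> pverts G" and ev: "evades G T S r0"
  shows "enat (Suc T) \<le> capt G S"
  unfolding capt_def
proof (rule INF_greatest)
  fix \<sigma> assume \<sigma>: "\<sigma> \<in> cop_strategies G"
  define good where "good t C r r' \<longleftrightarrow> step G r r' \<and> evades G t C r'" for t C r r'
  define \<rho> where "\<rho> h C = (case h of [] \<Rightarrow> r0 | (D, r) # h' \<Rightarrow>
      if \<exists>r'. good (T - length h) C r r' then SOME r'. good (T - length h) C r r' else r)"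
    for h :: "'a history" and C
  let ?C = "cops_at S \<sigma> \<rho>" and ?r = "robber_at S \<sigma> \<rho>"
  have "step G r (\<rho> ((C, r) # h) C')" for C r h C'
  proof (cases "\<exists>r'. good (T - length ((C, r) # h)) C' r r'")
    case True
    then have "\<rho> ((C, r) # h) C' = (SOME r'. good (T - length ((C, r) # h)) C' r r')"
      by (simp add: \<rho>_def)
    with someI_ex[OF True] have "good (T - length ((C, r) # h)) C' r (\<rho> ((C, r) # h) C')" by simp
    then show ?thesis unfolding good_def by blast
  next
    case False
    then show ?thesis by (auto simp: \<rho>_def step_def)
  qed
  then have \<rho>: "\<rho> \<in> robber_strategies G"
    using r0 by (simp add: robber_strategies_def \<rho>_def)
  have inv: "evades G (T - j) (?C j) (?r j) \<and> \<not> caught_in_round S \<sigma> \<rho> j" if "j \<le> T" for j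
    using that
  proof (induction j)
    case 0
    then show ?case using ev evades_not_caught[OF ev]
      by (simp add: cops_at_def robber_at_def \<rho>_def)
  next
    case (Suc j)
    obtain h where h: "play S \<sigma> \<rho> j = (?C j, ?r j) # h" "length h = j"
      using play_conv_Cons by metis
    have "T - j = Suc (T - Suc j)" using Suc.prems by simp
    moreover have "rel_mset (step G) (?C j) (?C (Suc j))"
      using \<sigma> h by (simp add: cops_at_Suc cop_strategies_def)
    ultimately have free: "?r j \<notin># ?C (Suc j)"
      and ex: "\<exists>r'. good (T - Suc j) (?C (Suc j)) (?r j) r'"
      using Suc unfolding good_def by auto
    have "?r (Suc j) = (SOME r'. good (T - Suc j) (?C (Suc j)) (?r j) r')"
      using ex h by (simp add: robber_at_Suc \<rho>_def)
    then have "evades G (T - Suc j) (?C (Suc j)) (?r (Suc j))"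
      using someI_ex[OF ex] by (simp add: good_def)
    with free evades_not_caught[OF this] show ?case by simp
  qed
  have "enat (Suc T) \<le> capture_time S \<sigma> \<rho>"
    unfolding capture_time_def using inv by (intro INF_greatest) (auto simp: not_less_eq_eq[symmetric])
  also have "\<dots> \<le> (SUP \<rho>\<in>robber_strategies G. capture_time S \<sigma> \<rho>)"
    by (rule SUP_upper[OF \<rho>])
  finally show "enat (Suc T) \<le> (SUP \<rho>\<in>robber_strategies G. capture_time S \<sigma> \<rho>)" .
qed

section \<open>Evasion inside a retract\<close>

lemma rel_mset_plusE:
  assumes "rel_mset R (M + N) C"
  obtains M' N' where "C = M' + N'" "rel_mset R M M'" "rel_mset R N N'"
proof -
  have "\<exists>M' N'. C = M' + N' \<and> rel_mset R M M' \<and> rel_mset R N N'"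
    using assms
  proof (induction M arbitrary: C)
    case empty
    then show ?case by (intro exI[of _ "{#}"] exI[of _ C]) simp
  next
    case (add x M)
    then obtain b C1 where C1: "C = add_mset b C1" "R x b" "rel_mset R (M + N) C1"
      using msed_rel_invL[of R x "M + N" C] by auto
    from add.IH[OF C1(3)] obtain M' N' where
      "C1 = M' + N'" "rel_mset R M M'" "rel_mset R N N'" by blast
    then show ?case using C1
      by (intro exI[of _ "add_mset b M'"] exI[of _ N']) (simp add: rel_mset_Plus)
  qed
  then show thesis using that by blast
qed

text \<open>
  The robber stays in the copy \<open>e ` pverts Q\<close> and plays against the images under the retraction
  \<open>f\<close> of the cops in \<open>M\<close>; the cops in \<open>N\<close> are too far away to reach the copy within \<open>t\<close> rounds.
\<close>

lemma evades_retract: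
  assumes wf: "pair_wf_digraph Q"
    and f: "\<And>u v. step H u v \<Longrightarrow> step Q (f u) (f v)"
    and e: "\<And>x y. x \<in> pverts Q \<Longrightarrow> y \<in> pverts Q \<Longrightarrow> step Q x y \<Longrightarrow> step H (e x) (e y)"
    and fe: "\<And>x. x \<in> pverts Q \<Longrightarrow> f (e x) = x"
    and d: "\<And>u v. step H u v \<Longrightarrow> d u \<le> Suc (d v)"
    and de: "\<And>x. x \<in> pverts Q \<Longrightarrow> d (e x) = (0::nat)"
  shows "evades Q t (image_mset f M) r \<Longrightarrow> r \<in> pverts Q \<Longrightarrow> (\<And>v. v \<in># N \<Longrightarrow> t < d v) \<Longrightarrow>
    evades H t (M + N) (e r)"
proof (induction t arbitrary: M N r)
  case 0
  then show ?case using fe[of r] de[of r] by (auto simp: image_iff) (metis less_irrefl)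
next
  case (Suc t)
  have free: "e r \<notin># M + N"
    using Suc.prems(2,3) evades_not_caught[OF Suc.prems(1)] fe[of r] de[of r]
    by (auto simp: image_iff) (metis not_less_zero)
  have "e r \<notin># C' \<and> (\<exists>r'. step H (e r) r' \<and> evades H t C' r')"
    if C': "rel_mset (step H) (M + N) C'" for C'
  proof -
    from C' obtain M' N' where MN: "C' = M' + N'"
      "rel_mset (step H) M M'" "rel_mset (step H) N N'" by (rule rel_mset_plusE)
    \<comment> \<open>One move lowers \<open>d\<close> by at most one, so the bound for
      \<open>Suc t\<close> rounds yields the one for \<open>t\<close>.\<close>
    have far: "t < d v" if v: "v \<in># N'" for v
    proof -
      from MN(3) v obtain u where "u \<in># N" "step H u v"
        by (auto simp: rel_mset_def list_all2_conv_all_nth in_set_conv_nth) metis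
      with Suc.prems(3) d show ?thesis by fastforce
    qed
    \<comment> \<open>The images of the near cops make a legal move in \<open>Q\<close>, and evasion
      in \<open>Q\<close> supplies the robber's answer.\<close>
    have "rel_mset (step Q) (image_mset f M) (image_mset f M')"
      unfolding multiset.rel_map using MN(2) by (rule multiset.rel_mono_strong) (rule f)
    with Suc.prems(1) obtain r' where r': "r \<notin># image_mset f M'" "step Q r r'"
      "evades Q t (image_mset f M') r'" by auto
    have "r' \<in> pverts Q"
      using r'(2) Suc.prems(2) pair_wf_digraph.in_arcsD2[OF wf] by (auto simp: step_def)
    then have "evades H t (M' + N') (e r')" "step H (e r) (e r')"
      using Suc.IH[OF r'(3) _ far] e r'(2) Suc.prems(2) by auto
    \<comment> \<open>A near cop on \<open>e r\<close> would project to \<open>r\<close>; a far cop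
      has positive \<open>d\<close>, while \<open>d\<close> vanishes on the copy.\<close>
    moreover have "e r \<notin># M' + N'"
      using r'(1) far fe[of r] de[of r] Suc.prems(2)
      by (auto simp: image_iff) (metis not_less_zero)
    ultimately show ?thesis using MN(1) by blast
  qed
  with free show ?case by simp
qed

lemma sum_size_filter_mset_le: "(\<Sum>i<s. size {#v \<in># S. p v = i#}) \<le> size S" for s :: nat
proof (induction S)
  case (add x S)
  have "(\<Sum>i<s. size {#v \<in># add_mset x S. p v = i#})
      = (\<Sum>i<s. size {#v \<in># S. p v = i#} + (if p x = i then 1 else 0))"
    by (intro sum.cong) auto
  also have "\<dots> \<le> size S + 1"
    using add.IH by (auto simp: sum.distrib)
  finally show ?case by simp
qed simp

text \<open>With at least \<open>s * cop_number Q\<close> cops, their number alone gives the bound.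
  Otherwise, by pigeonhole, some class \<open>i\<close> of \<open>p\<close> is short of cops, and
  the robber hides in copy \<open>i\<close>, which cops of other classes reach too late.\<close>

lemma cop_throttling_ge_if_retracts:
  fixes p :: "'b \<Rightarrow> nat" and d :: "nat \<Rightarrow> 'b \<Rightarrow> nat"
  assumes wf: "pair_wf_digraph Q"
    and f: "\<And>i u v. i < s \<Longrightarrow> step H u v \<Longrightarrow> step Q (f i u) (f i v)"
    and fV: "\<And>i v. i < s \<Longrightarrow> v \<in> pverts H \<Longrightarrow> f i v \<in> pverts Q"
    and eV: "\<And>i x. i < s \<Longrightarrow> x \<in> pverts Q \<Longrightarrow> e i x \<in> pverts H"
    and e: "\<And>i x y. i < s \<Longrightarrow> x \<in> pverts Q \<Longrightarrow> y \<in> pverts Q \<Longrightarrow> step Q x y \<Longrightarrow>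
      step H (e i x) (e i y)"
    and fe: "\<And>i x. i < s \<Longrightarrow> x \<in> pverts Q \<Longrightarrow> f i (e i x) = x"
    and d: "\<And>i u v. i < s \<Longrightarrow> step H u v \<Longrightarrow> d i u \<le> Suc (d i v)"
    and de: "\<And>i x. i < s \<Longrightarrow> x \<in> pverts Q \<Longrightarrow> d i (e i x) = 0"
    and far: "\<And>i v. i < s \<Longrightarrow> v \<in> pverts H \<Longrightarrow> p v \<noteq> i \<Longrightarrow> T < d i v"
  shows "enat (min (s * cop_number Q) (Suc T)) \<le> cop_throttling H"
  unfolding cop_throttling_def
proof (rule INF_greatest)
  fix k :: nat
  let ?c = "cop_number Q"
  show "enat (min (s * ?c) (Suc T)) \<le> enat k + capt_k k H"
  proof (cases "s * ?c \<le> k")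
    case True
    then have "enat (min (s * ?c) (Suc T)) \<le> enat k" by simp
    also have "\<dots> \<le> enat k + capt_k k H" by simp
    finally show ?thesis .
  next
    case False
    have "enat (Suc T) \<le> capt H S" if S: "S \<in> placements H k" for S
    proof -
      have "\<exists>i<s. size {#v \<in># S. p v = i#} < ?c"
      proof (rule ccontr)
        assume "\<not> ?thesis"
        then have "(\<Sum>i<s. ?c) \<le> (\<Sum>i<s. size {#v \<in># S. p v = i#})"
          by (intro sum_mono) auto
        with sum_size_filter_mset_le[where s = s and S = S and p = p] False S show False
          by (simp add: placements_def)
      qed
      then obtain i where i: "i < s" and small: "size {#v \<in># S. p v = i#} < ?c" by blast
      let ?M = "{#v \<in># S. p v = i#}" and ?N = "{#v \<in># S. p v \<noteq> i#}"
      have SV: "set_mset S \<subseteq> pverts H" using S by (simp add: placements_def)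
      then obtain r where r: "r \<in> pverts Q" "evades Q T (image_mset (f i) ?M) r"
        using evades_if_few_cops[of "image_mset (f i) ?M" Q T] small fV[OF i] by auto
      have "evades H T (?M + ?N) (e i r)"
      proof (rule evades_retract[OF wf _ _ _ _ _ r(2,1), where d = "d i"])
        show "T < d i v" if "v \<in># ?N" for v using far[OF i] that SV by auto
      qed (use f[OF i] e[OF i] fe[OF i] d[OF i] de[OF i] in auto)
      then have "evades H T S (e i r)" by (simp flip: multiset_partition)
      with eV[OF i r(1)] show ?thesis by (rule capt_ge_if_evades)
    qed
    then have "enat (Suc T) \<le> capt_k k H"
      unfolding capt_k_def by (rule INF_greatest)
    also have "\<dots> \<le> enat k + capt_k k H" by simp
    finally show ?thesis by (rule order_trans[rotated]) simp
  qed
qed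

section \<open>The spider graph\<close>

text \<open>
  Vertex \<open>(i, a)\<close> with \<open>i < s\<close> belongs to leg \<open>i\<close>: it is the vertex \<open>g a\<close> of a copy of \<open>Q\<close> if
  \<open>a < m\<close>, and a vertex of the path of \<open>m\<close> vertices leading from \<open>g (m - 1)\<close> to the hub \<open>(s, 0)\<close>
  otherwise. The vertices \<open>(s, a)\<close> form a path that pads the graph to the required order.
\<close>

definition spider_coords :: "nat \<Rightarrow> nat \<Rightarrow> nat \<Rightarrow> (nat \<times> nat) set" where
  "spider_coords m s r = {..<s} \<times> {..<2 * m} \<union> {s} \<times> {..<r}"

text \<open>For \<open>i < s\<close> the condition \<open>m \<le> b\<close> starts the path at the
  edge from \<open>m - 1\<close> to \<open>m\<close>, leaving only arcs of \<open>Q\<close> inside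
  the copy. For \<open>i = s\<close> the same clause yields the padding path.\<close>

fun spider_arc ::
  "'a pair_pre_digraph \<Rightarrow> (nat \<Rightarrow> 'a) \<Rightarrow> nat \<Rightarrow> nat \<Rightarrow> nat \<times> nat \<Rightarrow> nat \<times> nat \<Rightarrow> bool" where
  "spider_arc Q g m s (i, a) (j, b) \<longleftrightarrow>
     i = j \<and> i < s \<and> a < m \<and> b < m \<and> (g a, g b) \<in> parcs Q \<or>
     i = j \<and> b = Suc a \<and> (i < s \<longrightarrow> m \<le> b) \<or>
     i < s \<and> Suc a = 2 * m \<and> j = s \<and> b = 0"

text \<open>Coordinates are coded as naturals because the final graphs live on \<open>nat\<close>.
  Symmetrizing here lets \<open>spider_arc\<close> list path edges in one direction only.\<close>

definition spider ::
  "'a pair_pre_digraph \<Rightarrow> (nat \<Rightarrow> 'a) \<Rightarrow> nat \<Rightarrow> nat \<Rightarrow> nat \<Rightarrow> nat pair_pre_digraph" where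
  "spider Q g m s r =
     \<lparr>pverts = prod_decode -` spider_coords m s r,
      parcs = {(x, y). prod_decode x \<in> spider_coords m s r \<and> prod_decode y \<in> spider_coords m s r \<and>
        (spider_arc Q g m s (prod_decode x) (prod_decode y) \<or>
         spider_arc Q g m s (prod_decode y) (prod_decode x))}\<rparr>"

lemma card_spider: "card (pverts (spider Q g m s r)) = 2 * m * s + r"
proof -
  have "card (pverts (spider Q g m s r)) = card (spider_coords m s r)"
    unfolding spider_def using surj_prod_decode
    by (simp add: card_vimage_inj[OF inj_prod_decode])
  also have "\<dots> = card ({..<s} \<times> {..<2 * m}) + card ({s} \<times> {..<r})"
    unfolding spider_coords_def by (intro card_Un_disjoint) auto
  finally show ?thesis by (simp add: card_cartesian_product)
qed

lemma pair_graph_spider: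
  assumes "pair_graph Q"
  shows "pair_graph (spider Q g m s r)"
proof -
  interpret Q: pair_graph Q by fact
  let ?H = "spider Q g m s r"
  have fin: "finite (pverts ?H)"
    unfolding spider_def spider_coords_def
    by (simp add: finite_vimageI[OF _ inj_prod_decode])
  have sub: "parcs ?H \<subseteq> pverts ?H \<times> pverts ?H" by (auto simp: spider_def)
  have loop: "\<not> spider_arc Q g m s u u" for u
    using Q.pair_no_loops by (cases u) fastforce
  show ?thesis
  proof
    show "finite (pverts ?H)" by (rule fin)
    show "finite (parcs ?H)" using sub fin by (blast intro: finite_subset finite_cartesian_product)
    show "symmetric ?H" by (auto simp: symmetric_def sym_def spider_def)
    show "fst x \<noteq> snd x" if "x \<in> parcs ?H" for x
      using that loop[of "prod_decode (fst x)"] by (auto simp: spider_def)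
  qed (use sub in auto)
qed

text \<open>Every vertex reaches the hub: padding and legs along their paths, copies by a walk in
  \<open>Q\<close> to the attaching vertex \<open>g (m - 1)\<close>. Symmetry then joins any two
  vertices.\<close>

lemma connected_spider:
  assumes conn: "Digraph_Component.connected (with_proj Q)"
    and g: "bij_betw g {..<m} (pverts Q)" and "m \<ge> 1" and "r \<ge> 1"
  shows "Digraph_Component.connected (with_proj (spider Q g m s r))"
proof -
  let ?H = "spider Q g m s r" and ?V = "spider_coords m s r"
  let ?R = "rtrancl_on (pverts ?H) ((parcs ?H)\<^sup>s)"
  let ?c = "prod_encode (s, 0)"
  have c: "?c \<in> pverts ?H" using \<open>r \<ge> 1\<close> by (simp add: spider_def spider_coords_def)
  have link: "(prod_encode u, ?c) \<in> ?R" if "(prod_encode v, ?c) \<in> ?R"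
      "u \<in> ?V" "v \<in> ?V" "spider_arc Q g m s u v \<or> spider_arc Q g m s v u" for u v
  proof (rule converse_rtrancl_on_into_rtrancl_on[OF _ that(1)])
    show "(prod_encode u, prod_encode v) \<in> (parcs ?H)\<^sup>s"
      using that(2-4) by (simp add: spider_def symcl_def)
    show "prod_encode u \<in> pverts ?H" using that(2) by (simp add: spider_def)
  qed
  have centre: "(prod_encode (s, a), ?c) \<in> ?R" if "a < r" for a
    using that
  proof (induction a)
    case 0
    show ?case using c by (rule rtrancl_on_refl)
  next
    case (Suc a)
    then have "(prod_encode (s, a), ?c) \<in> ?R" by simp
    then show ?case by (rule link) (use Suc.prems in \<open>auto simp: spider_coords_def\<close>)
  qed
  \<comment> \<open>Downward induction from the vertex next to the hub; \<open>m \<le> Suc a\<close>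
    rather than \<open>m \<le> a\<close> includes the attaching vertex.\<close>
  have leg: "(prod_encode (i, a), ?c) \<in> ?R" if "i < s" "m \<le> Suc a" "a < 2 * m" for i a
  proof -
    have "a \<le> 2 * m - 1" using that by simp
    then show ?thesis using that(2)
    proof (induction rule: inc_induct)
      case base
      show ?case
        by (rule link[OF centre[of 0]])
          (use that(1) \<open>m \<ge> 1\<close> \<open>r \<ge> 1\<close> in \<open>auto simp: spider_coords_def\<close>)
    next
      case (step k)
      then have "(prod_encode (i, Suc k), ?c) \<in> ?R" by simp
      then show ?case
        by (rule link) (use step that(1) in \<open>auto simp: spider_coords_def\<close>)
    qed
  qed
  have body: "(prod_encode (i, a), ?c) \<in> ?R" if "i < s" "a < m" for i a
  proof -
    have gV: "g a' \<in> pverts Q" if "a' < m" for a' using g that by (auto simp: bij_betw_def)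
    have "(g a, g (m - 1)) \<in> rtrancl_on (pverts Q) ((parcs Q)\<^sup>s)"
      using conn gV[of a] gV[of "m - 1"] \<open>a < m\<close> by (simp add: connected_conv)
    \<comment> \<open>The walk lives in \<open>Q\<close>; quantifying over preimages under
      \<open>g\<close> carries it back to coordinates.\<close>
    moreover have "\<forall>a<m. g a = x \<longrightarrow> (prod_encode (i, a), ?c) \<in> ?R"
      if "(x, g (m - 1)) \<in> rtrancl_on (pverts Q) ((parcs Q)\<^sup>s)" for x
      using that
    proof (induction rule: converse_rtrancl_on_induct)
      case base
      show ?case
      proof (intro allI impI)
        fix a assume "a < m" "g a = g (m - 1)"
        with g \<open>m \<ge> 1\<close> have "a = m - 1" by (auto simp: bij_betw_def inj_on_def)
        with \<open>m \<ge> 1\<close> show "(prod_encode (i, a), ?c) \<in> ?R" by (intro leg[OF \<open>i < s\<close>]) auto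
      qed
    next
      case (step x y)
      obtain b where b: "b < m" "g b = y" using g step(4) by (metis bij_betw_iff_bijections lessThan_iff)
      with step(5) have reach_b: "(prod_encode (i, b), ?c) \<in> ?R" by blast
      show ?case
      proof (intro allI impI)
        fix a assume "a < m" "g a = x"
        then show "(prod_encode (i, a), ?c) \<in> ?R"
          by (intro link[OF reach_b, of "(i, a)"])
            (use step(1) b \<open>i < s\<close> in \<open>auto simp: spider_coords_def symcl_def\<close>)
      qed
    qed
    ultimately show ?thesis using \<open>a < m\<close> by blast
  qed
  have reach: "(x, ?c) \<in> ?R" if "x \<in> pverts ?H" for x
  proof -
    obtain i a where ia: "prod_decode x = (i, a)" by fastforce
    then have x: "x = prod_encode (i, a)" by (metis prod_decode_inverse)
    from ia that have "i < s \<and> a < 2 * m \<or> i = s \<and> a < r"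
      by (auto simp: spider_def spider_coords_def)
    then show ?thesis unfolding x using centre leg body
      by (metis not_less le_SucI)
  qed
  have "sym ?R" by (rule rtrancl_on_sym) (auto simp: sym_def symcl_def)
  then have "(x, y) \<in> ?R" if "x \<in> pverts ?H" "y \<in> pverts ?H" for x y
    using reach[OF that(1)] reach[OF that(2)] by (metis rtrancl_on_trans symD)
  then show ?thesis using c by (auto simp: connected_conv)
qed

lemma cop_throttling_spider_ge:
  assumes wf: "pair_wf_digraph Q" and sym: "symmetric Q"
    and g: "bij_betw g {..<m} (pverts Q)" and "m \<ge> 1"
  shows "enat (min (s * cop_number Q) (Suc m)) \<le> cop_throttling (spider Q g m s r)"
proof -
  let ?H = "spider Q g m s r"
  define idx where "idx = inv_into {..<m} g"
  have idx: "idx x < m" "g (idx x) = x" if "x \<in> pverts Q" for x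
    using that g bij_betw_inv_into_right[OF g] bij_betw_apply[OF bij_betw_inv_into[OF g]]
    unfolding idx_def by auto
  \<comment> \<open>Everything outside copy \<open>i\<close> collapses onto the attaching
    vertex.\<close>
  define f where "f i v = (case prod_decode v of (j, a) \<Rightarrow>
      if j = i \<and> a < m then g a else g (m - 1))" for i v
  define e where "e i x = prod_encode (i, idx x)" for i x
  \<comment> \<open>The distance from copy \<open>i\<close>, capped at its value
    \<open>m + 1\<close> at the hub; truncated subtraction gives \<open>0\<close> on the
    copy.\<close>
  define d where "d i v = (case prod_decode v of (j, a) \<Rightarrow>
      if j = i then Suc a - m else Suc m)" for i v
  have gV: "g a \<in> pverts Q" if "a < m" for a using g that by (auto simp: bij_betw_def)
  have symQ: "(y, x) \<in> parcs Q" if "(x, y) \<in> parcs Q" for x y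
    using sym that by (auto simp: symmetric_def dest: symD)
  show ?thesis
  proof (rule cop_throttling_ge_if_retracts[where f = f and e = e and d = d
        and p = "\<lambda>v. fst (prod_decode v)"])
    show "pair_wf_digraph Q" by fact
    fix i assume i: "i < s"
    show "f i v \<in> pverts Q" for v
      using gV \<open>m \<ge> 1\<close> by (auto simp: f_def split: prod.splits)
    show "e i x \<in> pverts ?H" if "x \<in> pverts Q" for x
      using idx(1)[OF that] i by (simp add: e_def spider_def spider_coords_def)
    show "f i (e i x) = x" "d i (e i x) = 0" if "x \<in> pverts Q" for x
      using idx[OF that] by (simp_all add: e_def f_def d_def)
    show "m < d i v" if "fst (prod_decode v) \<noteq> i" for v
      using that by (auto simp: d_def split: prod.splits)
    show "step ?H (e i x) (e i y)" if "x \<in> pverts Q" "y \<in> pverts Q" "step Q x y" for x y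
      using that i idx[OF that(1)] idx[OF that(2)]
      by (auto simp: step_def spider_def spider_coords_def e_def)
    fix u v assume uv: "step ?H u v"
    obtain j a k c where dec: "prod_decode u = (j, a)" "prod_decode v = (k, c)" by fastforce
    show "step Q (f i u) (f i v)"
    proof (cases "u = v")
      case False
      \<comment> \<open>An edge leaving a copy starts at coordinate \<open>m - 1\<close>, so
        \<open>f i\<close> contracts it to a point.\<close>
      have "a = m - 1" if "a < m" "m \<le> Suc a" for a using that by simp
      with False uv symQ show ?thesis using i \<open>m \<ge> 1\<close>
        by (auto simp: step_def spider_def spider_coords_def f_def dec)
    qed (simp add: step_def)
    show "d i u \<le> Suc (d i v)"
      using uv i dec \<open>m \<ge> 1\<close> by (auto simp: step_def spider_def spider_coords_def d_def)
  qed
qed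

section \<open>Choice of parameters and asymptotics\<close>

text \<open>
  With \<open>m \<approx> n\<^sup>\<gamma>\<close> and \<open>s \<approx> n / (2 m)\<close>, the product of \<open>s\<close> and \<open>m\<^sup>\<alpha>\<close> has order
  \<open>n\<close> to the power \<open>1 - \<gamma> + \<alpha> \<gamma> = \<gamma>\<close>.
\<close>

lemma spider_parameters_bound:
  fixes \<alpha> b \<gamma> :: real
  assumes "\<alpha> < 1" "0 \<le> \<alpha>" "b > 0" and \<gamma>: "\<gamma> = 1 / (2 - \<alpha>)" and c: "c = min 1 (b / 16)"
    and n: "n \<ge> 2" "16 powr (1 / (1 - \<gamma>)) \<le> real n"
    and m: "m = nat \<lceil>real n powr \<gamma>\<rceil>" and C: "b * real m powr \<alpha> \<le> real C"
  shows "c * real n powr \<gamma> \<le> real (min ((n - 1) div (2 * m) * C) (Suc m))"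
proof -
  define s where "s = (n - 1) div (2 * m)"
  have \<gamma>01: "0 < \<gamma>" "\<gamma> < 1" using assms by (simp_all add: \<gamma>)
  have ge1: "1 \<le> real n powr \<gamma>" using n \<gamma>01 by (simp add: ge_one_powr_ge_zero)
  have m_lower: "real n powr \<gamma> \<le> real m" unfolding m by linarith
  have m_upper: "real m \<le> 2 * real n powr \<gamma>" using ge1 unfolding m by linarith
  have m_pos: "0 < real m" using m_lower ge1 by linarith
  have split: "real n = real n powr \<gamma> * real n powr (1 - \<gamma>)"
    using n by (simp flip: powr_add)
  \<comment> \<open>The constant \<open>16\<close> ensures \<open>x / 8 - 1 \<ge> x / 16\<close> for
    \<open>x = real n powr (1 - \<gamma>)\<close>, which absorbs the rounding in
    \<open>s\<close>.\<close>
  have "16 = (16 powr (1 / (1 - \<gamma>))) powr (1 - \<gamma>)" using \<gamma>01 by (simp add: powr_powr)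
  also have "\<dots> \<le> real n powr (1 - \<gamma>)" using n \<gamma>01 by (intro powr_mono2) auto
  finally have big: "16 \<le> real n powr (1 - \<gamma>)" .
  have "n - 1 < 2 * m * Suc s"
    unfolding s_def using m_pos dividend_less_div_times[of "2 * m" "n - 1"] by (simp add: mult.commute)
  then have "real (n - 1) < real (2 * m * Suc s)" by (simp only: of_nat_less_iff)
  then have "real n - 1 < 2 * real m * (real s + 1)" using n by (simp add: of_nat_diff algebra_simps)
  also have "\<dots> \<le> 2 * (2 * real n powr \<gamma>) * (real s + 1)"
    using m_upper by (intro mult_right_mono mult_left_mono) auto
  finally have "real n / 2 < 4 * real n powr \<gamma> * (real s + 1)" using n by simp
  then have "real n powr \<gamma> * (real n powr (1 - \<gamma>) / 8) < real n powr \<gamma> * (real s + 1)"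
    using split by simp
  then have "real n powr (1 - \<gamma>) / 8 < real s + 1" using n(1)
    by (subst (asm) mult_less_cancel_left_pos) auto
  with big have s_lower: "real n powr (1 - \<gamma>) / 16 \<le> real s" by linarith
  have "b * real n powr (\<alpha> * \<gamma>) = b * (real n powr \<gamma>) powr \<alpha>"
    by (simp add: powr_powr mult.commute)
  also have "\<dots> \<le> b * real m powr \<alpha>"
    using m_lower assms(2,3) by (intro mult_left_mono powr_mono2) auto
  finally have C_lower: "b * real n powr (\<alpha> * \<gamma>) \<le> real C" using C by linarith
  have "1 - \<gamma> + \<alpha> * \<gamma> = \<gamma>" unfolding \<gamma> using assms(1) by (simp add: field_simps)
  then have "real n powr \<gamma> = real n powr (1 - \<gamma>) * real n powr (\<alpha> * \<gamma>)"
    by (metis powr_add)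
  then have "b / 16 * real n powr \<gamma> = real n powr (1 - \<gamma>) / 16 * (b * real n powr (\<alpha> * \<gamma>))"
    by simp
  also have "\<dots> \<le> real s * real C"
    using s_lower C_lower assms(3) by (intro mult_mono) auto
  finally have "b / 16 * real n powr \<gamma> \<le> real (s * C)" by simp
  \<comment> \<open>The minimum in \<open>c\<close> serves both cases: \<open>b / 16\<close> for the
    number of cops, \<open>1\<close> for the number of rounds.\<close>
  moreover have "c * real n powr \<gamma> \<le> b / 16 * real n powr \<gamma>"
    unfolding c by (intro mult_right_mono) auto
  moreover have "c * real n powr \<gamma> \<le> 1 * real n powr \<gamma>"
    unfolding c by (intro mult_right_mono) auto
  ultimately have "c * real n powr \<gamma> \<le> real (s * C)" "c * real n powr \<gamma> \<le> real (Suc m)"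
    using m_lower by linarith+
  then show ?thesis unfolding s_def[symmetric] min_def by presburger
qed

theorem theorem2p1:
  fixes \<alpha> b :: real and Q :: "nat \<Rightarrow> 'a pair_pre_digraph"
  assumes "1 / 2 \<le> \<alpha>" and "\<alpha> < 1" and "b > 0"
    and "\<And>n. n \<ge> 1 \<Longrightarrow> pair_graph (Q n)"
    and "\<And>n. n \<ge> 1 \<Longrightarrow> Digraph_Component.connected (with_proj (Q n))"
    and "\<And>n. n \<ge> 1 \<Longrightarrow> card (pverts (Q n)) = n"
    and "\<And>n. n \<ge> 1 \<Longrightarrow> real (cop_number (Q n)) \<ge> b * real n powr \<alpha>"
  shows "\<exists>H :: nat \<Rightarrow> nat pair_pre_digraph.
    (\<forall>n\<ge>1. pair_graph (H n) \<and> Digraph_Component.connected (with_proj (H n)) \<and>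
       card (pverts (H n)) = n) \<and>
    (\<lambda>n. real (the_enat (cop_throttling (H n)))) \<in> \<Omega>(\<lambda>n. real n powr (1 / (2 - \<alpha>)))"
proof -
  define \<gamma> where "\<gamma> = 1 / (2 - \<alpha>)"
  define m where "m n = nat \<lceil>real n powr \<gamma>\<rceil>" for n :: nat
  \<comment> \<open>Dividing \<open>n - 1\<close> rather than \<open>n\<close> reserves a vertex for
    the hub, hence \<open>r n \<ge> 1\<close>. For small \<open>n\<close>, \<open>s n\<close> may be
    \<open>0\<close>, and the graph is then a path.\<close>
  define s where "s n = (n - 1) div (2 * m n)" for n
  define r where "r n = n - 2 * m n * s n" for n
  define g where "g k = (SOME h. bij_betw h {..<k} (pverts (Q k)))" for k
  define H where "H n = spider (Q (m n)) (g (m n)) (m n) (s n) (r n)" for n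
  have g: "bij_betw (g k) {..<k} (pverts (Q k))" if "k \<ge> 1" for k
  proof -
    have "finite (pverts (Q k))"
      using assms(6)[OF that] that by (metis card.infinite not_one_le_zero)
    from ex_bij_betw_nat_finite[OF this] show ?thesis
      unfolding g_def assms(6)[OF that] atLeast0LessThan by (rule someI_ex)
  qed
  have m: "m n \<ge> 1" if "n \<ge> 1" for n
    using that unfolding m_def by (simp add: Suc_le_eq)
  have r: "2 * m n * s n + r n = n" "r n \<ge> 1" if "n \<ge> 1" for n
  proof -
    have "2 * m n * s n \<le> n - 1" unfolding s_def by (rule times_div_less_eq_dividend)
    then show "2 * m n * s n + r n = n" "r n \<ge> 1" using that unfolding r_def by simp_all
  qed
  have card: "card (pverts (H n)) = n" if "n \<ge> 1" for n
    unfolding H_def card_spider by (rule r[OF that])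
  have graph: "pair_graph (H n)" if "n \<ge> 1" for n
    unfolding H_def by (intro pair_graph_spider assms m that)
  have conn: "Digraph_Component.connected (with_proj (H n))" if "n \<ge> 1" for n
    unfolding H_def by (intro connected_spider assms g m r that)
  define c where "c = min 1 (b / 16)"
  have "c > 0" using assms(3) by (simp add: c_def)
  have bound: "c * real n powr \<gamma> \<le> real (the_enat (cop_throttling (H n)))"
    if n: "n \<ge> 2" "16 powr (1 / (1 - \<gamma>)) \<le> real n" for n
  proof -
    have n1: "n \<ge> 1" using n by simp
    interpret Q: pair_graph "Q (m n)" using assms(4) m[OF n1] .
    have "enat (min (s n * cop_number (Q (m n))) (Suc (m n))) \<le> cop_throttling (H n)"
      unfolding H_def
      by (intro cop_throttling_spider_ge g m n1 Q.pair_wf_digraph_axioms Q.pair_sym_arcs)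
    \<comment> \<open>The value of \<open>the_enat\<close> is specified only on finite arguments, so
      finiteness lets the bound pass through it.\<close>
    moreover have "cop_throttling (H n) \<noteq> \<infinity>"
    proof -
      have "finite (pverts (H n))" "pverts (H n) \<noteq> {}"
        using card[OF n1] n1 by (metis card.infinite not_one_le_zero, force)
      from cop_throttling_le_card[OF this] show ?thesis
        by (metis enat_ord_code(5))
    qed
    ultimately have "min (s n * cop_number (Q (m n))) (Suc (m n)) \<le> the_enat (cop_throttling (H n))"
      by (cases "cop_throttling (H n)") auto
    moreover have "c * real n powr \<gamma> \<le> real (min (s n * cop_number (Q (m n))) (Suc (m n)))"
      unfolding s_def
      by (rule spider_parameters_bound[OF assms(2) _ assms(3) \<gamma>_def c_def n m_def])
        (use assms(1,7) m[OF n1] in auto)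
    ultimately show ?thesis by (meson of_nat_le_iff order_trans)
  qed
  have "(\<lambda>n. real (the_enat (cop_throttling (H n)))) \<in> \<Omega>(\<lambda>n. real n powr \<gamma>)"
  proof (rule landau_omega.bigI[OF \<open>c > 0\<close>])
    have "eventually (\<lambda>n::nat. n \<ge> 2 \<and> 16 powr (1 / (1 - \<gamma>)) \<le> real n) at_top"
      using filterlim_real_sequentially unfolding filterlim_at_top
      by (intro eventually_conj eventually_ge_at_top) blast
    then show "eventually (\<lambda>n. c * norm (real n powr \<gamma>)
        \<le> norm (real (the_enat (cop_throttling (H n))))) at_top"
      by eventually_elim (use bound in simp)
  qed
  then show ?thesis using graph conn card unfolding \<gamma>_def by blast
qed

end
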